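(* Let $p_1,p_2\in(0,\infty)$ with $p_1<p_2$, let $r\in[1,\infty]$, and let $\varphi:\mathbb{R}^n\times[0,\infty)\to[0,\infty)$ be a Musielak-Orlicz function of uniformly lower type $p_\varphi^-$ and of uniformly upper type $p_\varphi^+$ with $0<p_1<p_\varphi^-\le p_\varphi^+<p_2<\infty$. Assume that $T$ is a sublinear operator defined on $L^{p_1}_{\varphi(\cdot,1)}(\mathbb{R}^n)+L^{p_2}_{\varphi(\cdot,1)}(\mathbb{R}^n)$ such that, for each $i\in\{1,2\}$, there is a positive constant $C_i$ with $$\varphi\left(\left\{x\in\mathbb{R}^n:\ \Big[\sum_j|Tf_j(x)|^r\Big]^{1/r}>\alpha\right\},t\right)\le C_i\,\alpha^{-p_i}\int_{\mathbb{R}^n}\Big[\sum_j|f_j(x)|^r\Big]^{p_i/r}\varphi(x,t)\,dx$$ for all $\{f_j\}_j\in L^{p_i}_{\varphi(\cdot,1)}(\ell^r,\mathbb{R}^n)$, $\alpha\in(0,\infty)$ and $t\in(0,\infty)$, where $C_i$ is independent of $\{f_j\}_j$, $t$ and $\alpha$. Then there exists a positive constant $C$ such that, for all $\{f_j\}_j\in L^\varphi(\ell^r,\mathbb{R}^n)$, $$\int_{\mathbb{R}^n}\varphi\left(x,\Big[\sum_j|Tf_j(x)|^r\Big]^{1/r}\right)dx\le C\int_{\mathbb{R}^n}\varphi\left(x,\Big[\sum_j|f_j(x)|^r\Big]^{1/r}\right)dx.$$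
   Context: An Orlicz function is a nondecreasing function $\Phi:[0,\infty)\to[0,\infty)$ with $\Phi(0)=0$, $\Phi(t)>0$ for $t\in(0,\infty)$ and $\lim_{t\to\infty}\Phi(t)=\infty$. A function $\varphi:\mathbb{R}^n\times[0,\infty)\to[0,\infty)$ is a Musielak-Orlicz function if $\varphi(x,\cdot)$ is an Orlicz function for every $x\in\mathbb{R}^n$ and $\varphi(\cdot,t)$ is measurable for every $t\in[0,\infty)$. It is of uniformly upper type $p$ (resp. uniformly lower type $p$), $p\in[0,\infty)$, if there is a positive constant $C$ such that $\varphi(x,st)\le Cs^p\varphi(x,t)$ for all $x\in\mathbb{R}^n$, $t\in[0,\infty)$ and $s\in[1,\infty)$ (resp. $s\in[0,1]$). For measurable $E\subset\mathbb{R}^n$ and $t\in[0,\infty)$, $\varphi(E,t):=\int_E\varphi(x,t)\,dx$. For $p\in(0,\infty)$, $L^p_{\varphi(\cdot,1)}(\mathbb{R}^n)$ is the space of measurable functions $f$ with $\int_{\mathbb{R}^n}|f(x)|^p\varphi(x,1)\,dx<\infty$. $L^\varphi(\mathbb{R}^n)$ is the space of measurable $f$ with $\int_{\mathbb{R}^n}\varphi(x,|f(x)|)\,dx<\infty$. Sequences are indexed by $j\in\mathbb{Z}$. $L^{p}_{\varphi(\cdot,1)}(\ell^r,\mathbb{R}^n)$ (resp. $L^\varphi(\ell^r,\mathbb{R}^n)$) is the set of all sequences $\{f_j\}_{j\in\mathbb{Z}}$ of measurable functions with $[\sum_j|f_j|^r]^{1/r}\in L^p_{\varphi(\cdot,1)}(\mathbb{R}^n)$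 (resp. $\in L^\varphi(\mathbb{R}^n)$). When $r=\infty$, $[\sum_j|a_j|^r]^{1/r}$ means $\sup_j|a_j|$. *)

theory Defs
  imports "HOL-Analysis.Analysis"
begin

text \<open>Functions on \<open>[0, \<infinity>)\<close> are represented by functions of type \<^typ>\<open>real \<Rightarrow> real\<close> whose
  values at negative arguments are irrelevant. Nonnegativity on \<open>[0, \<infinity>)\<close> follows from
  \<open>\<Phi> 0 = 0\<close> and monotonicity.\<close>

definition orlicz_function :: "(real \<Rightarrow> real) \<Rightarrow> bool" where
  "orlicz_function \<Phi> \<longleftrightarrow>
     mono_on {0..} \<Phi> \<and> \<Phi> 0 = 0 \<and> (\<forall>t>0. \<Phi> t > 0) \<and> filterlim \<Phi> at_top at_top"

definition musielak_orlicz :: "(real ^ 'n \<Rightarrow> real \<Rightarrow> real) \<Rightarrow> bool" where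
  "musielak_orlicz \<phi> \<longleftrightarrow>
     (\<forall>x. orlicz_function (\<phi> x)) \<and> (\<forall>t\<ge>0. (\<lambda>x. \<phi> x t) \<in> borel_measurable lebesgue)"

definition uniformly_upper_type :: "(real ^ 'n \<Rightarrow> real \<Rightarrow> real) \<Rightarrow> real \<Rightarrow> bool" where
  "uniformly_upper_type \<phi> p \<longleftrightarrow>
     (\<exists>C>0. \<forall>x. \<forall>t\<ge>0. \<forall>s\<ge>1. \<phi> x (s * t) \<le> C * s powr p * \<phi> x t)"

definition uniformly_lower_type :: "(real ^ 'n \<Rightarrow> real \<Rightarrow> real) \<Rightarrow> real \<Rightarrow> bool" where
  "uniformly_lower_type \<phi> p \<longleftrightarrow>
     (\<exists>C>0. \<forall>x. \<forall>t\<ge>0. \<forall>s\<in>{0..1}. \<phi> x (s * t) \<le> C * s powr p * \<phi> x t)"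

text \<open>The set function \<open>\<phi>(E, t)\<close>.\<close>

definition mo_measure :: "(real ^ 'n \<Rightarrow> real \<Rightarrow> real) \<Rightarrow> (real ^ 'n) set \<Rightarrow> real \<Rightarrow> ennreal" where
  "mo_measure \<phi> E t = (\<integral>\<^sup>+ x\<in>E. ennreal (\<phi> x t) \<partial>lebesgue)"

text \<open>The quantity \<open>[\<Sum>\<^sub>j |a\<^sub>j|\<^sup>r]\<^sup>1\<^sup>/\<^sup>r\<close> may be infinite, so it is \<^typ>\<open>ennreal\<close>-valued.
  Accordingly real powers (with positive exponent) and Orlicz functions are extended to
  \<open>\<infinity>\<close> by their limit \<open>\<infinity>\<close>.\<close>

definition rpow :: "ennreal \<Rightarrow> real \<Rightarrow> ennreal" where
  "rpow a p = (if a = \<infinity> then \<infinity> else ennreal (enn2real a powr p))"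

definition orlicz_ext :: "(real \<Rightarrow> real) \<Rightarrow> ennreal \<Rightarrow> ennreal" where
  "orlicz_ext \<Phi> a = (if a = \<infinity> then \<infinity> else ennreal (\<Phi> (enn2real a)))"

definition lr_norm :: "ennreal \<Rightarrow> (int \<Rightarrow> 'a::real_normed_vector) \<Rightarrow> ennreal" where
  "lr_norm r a =
     (if r = \<infinity> then (SUP j. ennreal (norm (a j)))
      else rpow (\<Sum>\<^sub>\<infinity>j. ennreal (norm (a j) powr enn2real r)) (1 / enn2real r))"

text \<open>The integrals \<open>\<integral> |g|\<^sup>p \<phi>(x,t) dx\<close> and \<open>\<integral> \<phi>(x, |g|) dx\<close>, for
  \<open>[0, \<infinity>]\<close>-valued \<open>g\<close>. A Musielak-Orlicz function need not be jointly measurable, and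
  \<open>x \<mapsto> \<phi>(x, g x)\<close> may fail to be measurable; \<open>\<integral>\<^sup>+\<close> is then the lower integral.\<close>

definition power_modular ::
    "(real ^ 'n \<Rightarrow> real \<Rightarrow> real) \<Rightarrow> real \<Rightarrow> real \<Rightarrow> (real ^ 'n \<Rightarrow> ennreal) \<Rightarrow> ennreal" where
  "power_modular \<phi> t p g = (\<integral>\<^sup>+ x. rpow (g x) p * ennreal (\<phi> x t) \<partial>lebesgue)"

definition mo_modular ::
    "(real ^ 'n \<Rightarrow> real \<Rightarrow> real) \<Rightarrow> (real ^ 'n \<Rightarrow> ennreal) \<Rightarrow> ennreal" where
  "mo_modular \<phi> g = (\<integral>\<^sup>+ x. orlicz_ext (\<phi> x) (g x) \<partial>lebesgue)"

text \<open>The scalar class \<open>{real_normed_field, euclidean_space}\<close> below covers both real-valued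
  and complex-valued functions.\<close>

definition Lp_weighted ::
    "(real ^ 'n \<Rightarrow> real \<Rightarrow> real) \<Rightarrow> real \<Rightarrow>
     (real ^ 'n \<Rightarrow> 'a::{real_normed_field, euclidean_space}) set" where
  "Lp_weighted \<phi> p =
     {f. f \<in> borel_measurable lebesgue \<and> power_modular \<phi> 1 p (\<lambda>x. ennreal (norm (f x))) < \<infinity>}"

definition Lp_weighted_seq ::
    "(real ^ 'n \<Rightarrow> real \<Rightarrow> real) \<Rightarrow> real \<Rightarrow> ennreal \<Rightarrow>
     (int \<Rightarrow> real ^ 'n \<Rightarrow> 'a::{real_normed_field, euclidean_space}) set" where
  "Lp_weighted_seq \<phi> p r =
     {f. (\<forall>j. f j \<in> borel_measurable lebesgue) \<and>
         power_modular \<phi> 1 p (\<lambda>x. lr_norm r (\<lambda>j. f j x)) < \<infinity>}"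

definition L_mo_seq ::
    "(real ^ 'n \<Rightarrow> real \<Rightarrow> real) \<Rightarrow> ennreal \<Rightarrow>
     (int \<Rightarrow> real ^ 'n \<Rightarrow> 'a::{real_normed_field, euclidean_space}) set" where
  "L_mo_seq \<phi> r =
     {f. (\<forall>j. f j \<in> borel_measurable lebesgue) \<and>
         mo_modular \<phi> (\<lambda>x. lr_norm r (\<lambda>j. f j x)) < \<infinity>}"

definition fun_set_sum :: "('b \<Rightarrow> 'a::plus) set \<Rightarrow> ('b \<Rightarrow> 'a) set \<Rightarrow> ('b \<Rightarrow> 'a) set" where
  "fun_set_sum A B = {(\<lambda>x. g x + h x) | g h. g \<in> A \<and> h \<in> B}"

text \<open>A sublinear operator on \<open>D\<close> with measurable functions as values. Functions, not classes
  of functions, are used, so the relations hold almost everywhere. Values of \<open>T\<close> outside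
  \<open>D\<close> are unconstrained.\<close>

definition sublinear_operator_on ::
    "(real ^ 'n \<Rightarrow> 'a::{real_normed_field, euclidean_space}) set \<Rightarrow>
     ((real ^ 'n \<Rightarrow> 'a) \<Rightarrow> real ^ 'n \<Rightarrow> 'a) \<Rightarrow> bool" where
  "sublinear_operator_on D T \<longleftrightarrow>
     (\<forall>f\<in>D. T f \<in> borel_measurable lebesgue) \<and>
     (\<forall>f\<in>D. \<forall>g\<in>D. AE x in lebesgue. norm (T (\<lambda>y. f y + g y) x) \<le> norm (T f x) + norm (T g x)) \<and>
     (\<forall>f\<in>D. \<forall>c. AE x in lebesgue. norm (T (\<lambda>y. c * f y) x) = norm c * norm (T f x))"

end

theory Submission
  imports Defs
begin

text \<open>The theorem is a Marcinkiewicz interpolation argument in which the integral over all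
  heights is replaced by a sum over the dyadic heights \<open>2\<^sup>k\<close>, \<open>k \<in> \<int>\<close>. Write \<open>F\<close> and \<open>G\<close> for
  the \<open>\<ell>\<^sup>r\<close> norms of \<open>{f\<^sub>j}\<close> and \<open>{T f\<^sub>j}\<close>. The upper type makes \<open>\<phi>(x, \<cdot>)\<close> doubling, so
  \<open>\<phi>(x, G(x))\<close> is at most a constant times the sum of \<open>\<phi>(x, 2\<^sup>k)\<close> over those \<open>k\<close> with
  \<open>2\<^sup>k < G(x)\<close> (\<open>orlicz_ext_le_dyadic_sum\<close>). Integrating turns the left-hand side into the sum
  of the numbers \<open>\<phi>({G > 2\<^sup>k}, 2\<^sup>k)\<close>.

  For each \<open>k\<close> the whole sequence is cut where \<open>F\<close> crosses \<open>2\<^sup>k\<close>. Sublinearity and the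
  quasi-triangle inequality for the \<open>\<ell>\<^sup>r\<close> norm put \<open>{G > 2\<^sup>k}\<close> inside two level sets at height
  \<open>2\<^sup>k / 4\<close>, one for each part, up to a null set; the weak type inequality with exponent \<open>p\<^sub>1\<close>
  is applied to the part where \<open>F > 2\<^sup>k\<close>, the one with \<open>p\<^sub>2\<close> to the part where
  \<open>F \<le> 2\<^sup>k\<close>, both at \<open>t = 2\<^sup>k\<close> (\<open>level_set_estimate\<close>). This bounds
  \<open>\<phi>({G > 2\<^sup>k}, 2\<^sup>k)\<close> by the integrals of \<open>(F / 2\<^sup>k)\<^bsup>p\<^sub>1\<^esup> \<phi>(x, 2\<^sup>k)\<close> over \<open>{F > 2\<^sup>k}\<close> and of
  \<open>(F / 2\<^sup>k)\<^bsup>p\<^sub>2\<^esup> \<phi>(x, 2\<^sup>k)\<close> over \<open>{F \<le> 2\<^sup>k}\<close>.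

  The sums over \<open>k\<close> are estimated pointwise in \<open>x\<close>. If \<open>2\<^sup>k < F\<close>, the lower type gives
  \<open>\<phi>(x, 2\<^sup>k) \<le> C (2\<^sup>k / F)\<^bsup>p\<^sup>-\<^esup> \<phi>(x, F)\<close>, and the factor \<open>(2\<^sup>k / F)\<^bsup>p\<^sup>- - p\<^sub>1\<^esup>\<close> that remains
  is summed as a geometric series because \<open>p\<^sub>1 < p\<^sup>-\<close>; the upper type and \<open>p\<^sup>+ < p\<^sub>2\<close> do the
  same for \<open>F \<le> 2\<^sup>k\<close> (\<open>sum_upper_piece_le\<close>, \<open>sum_lower_piece_le\<close>). Both sums are at most a
  constant times \<open>\<phi>(x, F(x))\<close>. The same bounds show that the two parts lie in the weighted
  \<open>L\<^sup>p\<close> classes on which the weak type inequalities are assumed.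

  The functions \<open>x \<mapsto> \<phi>(x, F(x))\<close> and \<open>x \<mapsto> \<phi>(x, G(x))\<close> may be nonmeasurable, so their
  integrals are lower integrals. The argument only compares them with dyadic sums, which are
  measurable because \<open>\<phi>(\<cdot>, 2\<^sup>k)\<close> is, and sums and integrals are interchanged only for those.\<close>

section \<open>The extended power and the sequence norm\<close>

lemma rpow_0 [simp]: "rpow 0 p = 0"
  by (simp add: rpow_def)

lemma rpow_mono: "0 \<le> p \<Longrightarrow> a \<le> b \<Longrightarrow> rpow a p \<le> rpow b p"
  by (auto simp: rpow_def top_unique less_top intro!: ennreal_leI powr_mono2 enn2real_mono)

lemma rpow_mult_ennreal:
  assumes "0 < c"
  shows "rpow (ennreal c * a) p = ennreal (c powr p) * rpow a p"
  using assms
  by (cases a) (auto simp: rpow_def ennreal_mult_top ennreal_mult[symmetric] powr_mult)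

lemma borel_measurable_rpow [measurable]: "(\<lambda>a. rpow a p) \<in> borel_measurable borel"
  unfolding rpow_def by measurable

text \<open>For \<open>[0, \<infinity>]\<close>-valued terms no convergence question arises; the supremum form yields
  measurability when the index type is countable, and inequalities by comparing finite sums.\<close>

lemma infsum_ennreal_SUP:
  fixes f :: "'i \<Rightarrow> ennreal"
  shows "infsum f UNIV = (SUP F\<in>Collect finite. sum f F)"
  by (simp add: nonneg_infsum_complete)

lemma lr_norm_0 [simp]: "lr_norm r (\<lambda>j. 0) = 0"
  by (simp add: lr_norm_def)

lemma borel_measurable_lr_norm [measurable (raw)]:
  fixes f :: "int \<Rightarrow> 'x \<Rightarrow> 'a :: real_normed_vector"
  assumes [measurable]: "\<And>j. f j \<in> borel_measurable M"
  shows "(\<lambda>x. lr_norm r (\<lambda>j. f j x)) \<in> borel_measurable M"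
proof (cases "r = \<infinity>")
  case False
  have "(\<lambda>x. SUP F\<in>Collect finite. \<Sum>j\<in>F. ennreal (norm (f j x) powr enn2real r)) \<in> borel_measurable M"
    by (intro borel_measurable_SUP countable_Collect_finite) measurable
  then show ?thesis
    using False by (simp add: lr_norm_def infsum_ennreal_SUP)
qed (simp add: lr_norm_def)

lemma norm_le_lr_norm:
  assumes "1 \<le> r"
  shows "ennreal (norm (a j)) \<le> lr_norm r a"
proof (cases "r = \<infinity>")
  case True
  then show ?thesis
    by (auto simp: lr_norm_def intro: SUP_upper)
next
  case False
  define \<rho> where "\<rho> = enn2real r"
  have \<rho>: "1 \<le> \<rho>"
    using assms False unfolding \<rho>_def by (cases r) auto
  have "ennreal (norm (a j) powr \<rho>) \<le> (\<Sum>\<^sub>\<infinity>j. ennreal (norm (a j) powr \<rho>))"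
    unfolding infsum_ennreal_SUP by (rule SUP_upper2[of "{j}"]) auto
  then have "rpow (ennreal (norm (a j) powr \<rho>)) (1 / \<rho>) \<le> lr_norm r a"
    using \<rho> False by (simp add: lr_norm_def \<rho>_def[symmetric] rpow_mono)
  then show ?thesis
    using \<rho> by (simp add: rpow_def powr_powr)
qed

text \<open>The cut is made by a condition on \<open>x\<close> common to all indices, so it commutes with the
  sequence norm.\<close>

lemma lr_norm_if: "lr_norm r (\<lambda>j. if P then a j else 0) = (if P then lr_norm r a else 0)"
  by simp

lemma powr_add_le:
  fixes a b \<rho> :: real
  assumes "0 \<le> a" "0 \<le> b" "0 \<le> \<rho>"
  shows "(a + b) powr \<rho> \<le> 2 powr \<rho> * (a powr \<rho> + b powr \<rho>)"
proof -
  have "(a + b) powr \<rho> \<le> (2 * max a b) powr \<rho>"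
    using assms by (intro powr_mono2) auto
  also have "\<dots> = 2 powr \<rho> * max a b powr \<rho>"
    using assms by (simp add: powr_mult)
  also have "\<dots> \<le> 2 powr \<rho> * (a powr \<rho> + b powr \<rho>)"
    by (intro mult_left_mono) (auto simp: max_def)
  finally show ?thesis .
qed

text \<open>Minkowski's inequality would give the sum of the two norms. A constant multiple of the
  maximum suffices for comparing level sets and needs only \<open>(s + t)\<^sup>\<rho> \<le> 2\<^sup>\<rho> (s\<^sup>\<rho> + t\<^sup>\<rho>)\<close>: the
  resulting constant is \<open>2\<^bsup>1 + 1/\<rho>\<^esup>\<close>, which is at most \<open>4\<close> for \<open>\<rho> \<ge> 1\<close>.\<close>

lemma lr_norm_quasi_triangle:
  fixes a b c :: "int \<Rightarrow> 'a :: real_normed_vector"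
  assumes r: "1 \<le> r" and le: "\<And>j. norm (c j) \<le> norm (a j) + norm (b j)"
  shows "lr_norm r c \<le> 4 * max (lr_norm r a) (lr_norm r b)"
proof (cases "r = \<infinity>")
  case True
  have "ennreal (norm (c j)) \<le> 4 * max (lr_norm r a) (lr_norm r b)" for j
  proof -
    have "ennreal (norm (c j)) \<le> ennreal (norm (a j)) + ennreal (norm (b j))"
      using le[of j] by (simp flip: ennreal_plus)
    also have "\<dots> \<le> lr_norm r a + lr_norm r b"
      using True by (auto simp: lr_norm_def intro!: add_mono SUP_upper)
    also have "\<dots> \<le> 2 * max (lr_norm r a) (lr_norm r b)"
      by (simp add: mult_2 add_mono)
    also have "\<dots> \<le> 4 * max (lr_norm r a) (lr_norm r b)"
      by (intro mult_right_mono) auto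
    finally show ?thesis .
  qed
  then show ?thesis
    using True by (subst lr_norm_def) (auto intro: SUP_least)
next
  case False
  define \<rho> where "\<rho> = enn2real r"
  have \<rho>: "1 \<le> \<rho>"
    using r False unfolding \<rho>_def by (cases r) auto
  define S where "S d = (\<Sum>\<^sub>\<infinity>j. ennreal (norm (d j) powr \<rho>))" for d :: "int \<Rightarrow> 'a"
  have lr: "lr_norm r d = rpow (S d) (1 / \<rho>)" for d :: "int \<Rightarrow> 'a"
    using False by (simp add: lr_norm_def S_def \<rho>_def)
  have S_upper: "(\<Sum>j\<in>F. ennreal (norm (d j) powr \<rho>)) \<le> S d" if "finite F" for d F
    unfolding S_def infsum_ennreal_SUP using that by (auto intro: SUP_upper)
  have "S c \<le> ennreal (2 powr \<rho>) * (S a + S b)"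
    unfolding S_def[of c] infsum_ennreal_SUP
  proof (rule SUP_least)
    fix F :: "int set" assume "F \<in> Collect finite"
    then have F: "finite F" by simp
    have "(\<Sum>j\<in>F. ennreal (norm (c j) powr \<rho>))
        \<le> (\<Sum>j\<in>F. ennreal (2 powr \<rho>) * (ennreal (norm (a j) powr \<rho>) + ennreal (norm (b j) powr \<rho>)))"
    proof (rule sum_mono)
      fix j
      have "norm (c j) powr \<rho> \<le> (norm (a j) + norm (b j)) powr \<rho>"
        using le \<rho> by (intro powr_mono2) auto
      also have "\<dots> \<le> 2 powr \<rho> * (norm (a j) powr \<rho> + norm (b j) powr \<rho>)"
        using \<rho> by (intro powr_add_le) auto
      finally show "ennreal (norm (c j) powr \<rho>)
          \<le> ennreal (2 powr \<rho>) * (ennreal (norm (a j) powr \<rho>) + ennreal (norm (b j) powr \<rho>))"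
        by (simp flip: ennreal_plus ennreal_mult)
    qed
    also have "\<dots> = ennreal (2 powr \<rho>) * ((\<Sum>j\<in>F. ennreal (norm (a j) powr \<rho>))
                                        + (\<Sum>j\<in>F. ennreal (norm (b j) powr \<rho>)))"
      by (simp add: sum.distrib flip: sum_distrib_left)
    also have "\<dots> \<le> ennreal (2 powr \<rho>) * (S a + S b)"
      using F by (intro mult_left_mono add_mono S_upper) auto
    finally show "(\<Sum>j\<in>F. ennreal (norm (c j) powr \<rho>)) \<le> ennreal (2 powr \<rho>) * (S a + S b)" .
  qed
  also have "\<dots> \<le> ennreal (2 powr \<rho>) * (ennreal 2 * max (S a) (S b))"
    by (intro mult_left_mono) (auto simp: mult_2 add_mono)
  also have "\<dots> = ennreal (2 powr (\<rho> + 1)) * max (S a) (S b)"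
    by (simp add: powr_add ennreal_mult mult.assoc)
  finally have "lr_norm r c \<le> rpow (ennreal (2 powr (\<rho> + 1)) * max (S a) (S b)) (1 / \<rho>)"
    using \<rho> by (simp add: lr rpow_mono)
  also have "\<dots> = ennreal (2 powr ((\<rho> + 1) / \<rho>)) * rpow (max (S a) (S b)) (1 / \<rho>)"
    by (simp add: rpow_mult_ennreal powr_powr)
  also have "\<dots> = ennreal (2 powr ((\<rho> + 1) / \<rho>)) * max (lr_norm r a) (lr_norm r b)"
    using \<rho> by (simp add: lr max_of_mono[of "\<lambda>s. rpow s (1 / \<rho>)", OF monoI] rpow_mono)
  also have "\<dots> \<le> 4 * max (lr_norm r a) (lr_norm r b)"
  proof (rule mult_right_mono)
    have "2 powr ((\<rho> + 1) / \<rho>) \<le> (2::real) powr 2"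
      using \<rho> by (intro powr_mono) (auto simp: field_simps)
    then show "ennreal (2 powr ((\<rho> + 1) / \<rho>)) \<le> 4"
      by (simp add: ennreal_le_iff2 flip: ennreal_numeral)
  qed simp
  finally show ?thesis .
qed

section \<open>Lower integrals\<close>

text \<open>The integrand may be nonmeasurable: multiplication by \<open>c\<close> is a bijection between the
  simple functions below \<open>f\<close> and those below \<open>c f\<close>.\<close>

lemma nn_integral_cmult_le:
  assumes c: "0 < c"
  shows "(\<integral>\<^sup>+x. ennreal c * f x \<partial>M) \<le> ennreal c * (\<integral>\<^sup>+x. f x \<partial>M)"
  unfolding nn_integral_def[of M "\<lambda>x. ennreal c * f x"]
proof (rule SUP_least, safe)
  fix g assume g: "simple_function M g" "g \<le> (\<lambda>x. ennreal c * f x)"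
  note [measurable] = borel_measurable_simple_function[OF g(1)]
  have inv: "ennreal (1 / c) * (ennreal c * y) = y" "ennreal c * (ennreal (1 / c) * y) = y" for y
    using c by (simp_all flip: ennreal_mult mult.assoc)
  have le: "ennreal (1 / c) * g x \<le> f x" for x
    using mult_left_mono[of "g x" "ennreal c * f x" "ennreal (1 / c)"] g(2)
    by (simp add: inv le_fun_def)
  have "integral\<^sup>S M g = (\<integral>\<^sup>+x. ennreal c * (ennreal (1 / c) * g x) \<partial>M)"
    using g by (simp add: inv nn_integral_eq_simple_integral)
  also have "\<dots> = ennreal c * (\<integral>\<^sup>+x. ennreal (1 / c) * g x \<partial>M)"
    by (rule nn_integral_cmult) measurable
  also have "\<dots> \<le> ennreal c * (\<integral>\<^sup>+x. f x \<partial>M)"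
    using le by (intro mult_left_mono nn_integral_mono) auto
  finally show "integral\<^sup>S M g \<le> ennreal c * (\<integral>\<^sup>+x. f x \<partial>M)" .
qed

section \<open>Dyadic geometric series\<close>

lemma ex_dyadic_interval:
  fixes t :: real
  assumes "0 < t"
  obtains m :: int where "2 powr m < t" "t \<le> 2 powr (m + 1)"
proof -
  define m where "m = \<lceil>log 2 t\<rceil> - 1"
  have "(2::real) powr m < 2 powr (log 2 t)" "2 powr (log 2 t) \<le> (2::real) powr (m + 1)"
    unfolding m_def by (intro powr_less_mono powr_mono; linarith)+
  then show thesis
    using assms by (intro that[of m]) auto
qed

lemma nn_integral_geometric:
  assumes "0 \<le> q" "q < (1::real)"
  shows "(\<integral>\<^sup>+n. ennreal (q ^ n) \<partial>count_space (UNIV::nat set)) = ennreal (1 / (1 - q))"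
  using assms by (simp add: nn_integral_count_space_nat suminf_ennreal_eq geometric_sums)

text \<open>If \<open>2\<^sup>m < u \<le> 2\<^bsup>m+1\<^esup>\<close>, the admissible indices are those with \<open>k \<le> m\<close>, and there
  \<open>2\<^sup>k / u < 2\<^bsup>k - m\<^esup>\<close>; hence the bound does not depend on \<open>u\<close>.\<close>

lemma sum_dyadic_below:
  fixes u \<delta> :: real
  assumes u: "0 < u" and \<delta>: "0 < \<delta>"
  shows "(\<integral>\<^sup>+k. (if 2 powr real_of_int k < u then ennreal ((2 powr k / u) powr \<delta>) else 0) \<partial>count_space UNIV)
    \<le> ennreal (1 / (1 - 2 powr - \<delta>))" (is "?lhs \<le> _")
proof -
  obtain m :: int where m: "2 powr m < u" "u \<le> 2 powr (m + 1)"
    using ex_dyadic_interval[OF u] .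
  have below: "k \<le> m" if "2 powr real_of_int k < u" for k
  proof -
    have "(2::real) powr k < 2 powr (m + 1)" using that m by linarith
    then show ?thesis by simp
  qed
  have "?lhs \<le> (\<integral>\<^sup>+k. ennreal ((2 powr (k - m)) powr \<delta>) * indicator {..m} k \<partial>count_space UNIV)"
    using below m u \<delta>
    by (intro nn_integral_mono)
       (auto simp: powr_diff indicator_def intro!: ennreal_leI powr_mono2 divide_left_mono)
  also have "\<dots> = (\<integral>\<^sup>+k. ennreal ((2 powr (k - m)) powr \<delta>) \<partial>count_space {..m})"
    by (subst nn_integral_count_space_indicator) auto
  also have "\<dots> = (\<integral>\<^sup>+n. ennreal ((2 powr (real_of_int (m - int n) - m)) powr \<delta>) \<partial>count_space UNIV)"
    by (subst nn_integral_bij_count_space[of "\<lambda>n. m - int n" UNIV, symmetric])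
       (auto intro!: bij_betwI[where g = "\<lambda>k. nat (m - k)"])
  also have "\<dots> = (\<integral>\<^sup>+n. ennreal ((2 powr - \<delta>) ^ n) \<partial>count_space UNIV)"
    by (intro nn_integral_cong) (simp add: powr_powr powr_realpow[symmetric] mult.commute)
  also have "\<dots> = ennreal (1 / (1 - 2 powr - \<delta>))"
    using \<delta> powr_less_mono[of "- \<delta>" 0 "2::real"] by (intro nn_integral_geometric) auto
  finally show ?thesis .
qed

text \<open>Here the admissible indices satisfy \<open>k \<ge> m + 1\<close>, and \<open>u / 2\<^sup>k \<le> 2\<^bsup>m + 1 - k\<^esup>\<close>.\<close>

lemma sum_dyadic_above:
  fixes u \<delta> :: real
  assumes u: "0 < u" and \<delta>: "0 < \<delta>"
  shows "(\<integral>\<^sup>+k. (if u \<le> 2 powr real_of_int k then ennreal ((u / 2 powr k) powr \<delta>) else 0) \<partial>count_space UNIV)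
    \<le> ennreal (1 / (1 - 2 powr - \<delta>))" (is "?lhs \<le> _")
proof -
  obtain m :: int where m: "2 powr m < u" "u \<le> 2 powr (m + 1)"
    using ex_dyadic_interval[OF u] .
  have above: "m + 1 \<le> k" if "u \<le> 2 powr real_of_int k" for k
  proof -
    have "(2::real) powr m < 2 powr k" using that m by linarith
    then show ?thesis by simp
  qed
  have "?lhs \<le> (\<integral>\<^sup>+k. ennreal ((2 powr (m + 1 - k)) powr \<delta>) * indicator {m + 1..} k \<partial>count_space UNIV)"
    using above m u \<delta>
    by (intro nn_integral_mono)
       (auto simp: powr_diff indicator_def intro!: ennreal_leI powr_mono2 divide_right_mono)
  also have "\<dots> = (\<integral>\<^sup>+k. ennreal ((2 powr (m + 1 - k)) powr \<delta>) \<partial>count_space {m + 1..})"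
    by (subst nn_integral_count_space_indicator) auto
  also have "\<dots> = (\<integral>\<^sup>+n. ennreal ((2 powr (m + 1 - real_of_int (m + 1 + int n))) powr \<delta>) \<partial>count_space UNIV)"
    by (subst nn_integral_bij_count_space[of "\<lambda>n. m + 1 + int n" UNIV, symmetric])
       (auto intro!: bij_betwI[where g = "\<lambda>k. nat (k - m - 1)"])
  also have "\<dots> = (\<integral>\<^sup>+n. ennreal ((2 powr - \<delta>) ^ n) \<partial>count_space UNIV)"
    by (intro nn_integral_cong) (simp add: powr_powr powr_realpow[symmetric] mult.commute)
  also have "\<dots> = ennreal (1 / (1 - 2 powr - \<delta>))"
    using \<delta> powr_less_mono[of "- \<delta>" 0 "2::real"] by (intro nn_integral_geometric) auto
  finally show ?thesis .
qed

section \<open>Pointwise estimates for one Orlicz function\<close>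

text \<open>With \<open>u = F(x)\<close> and \<open>\<Phi> = \<phi>(x, \<cdot>)\<close> this is the integrand \<open>(u / a)\<^sup>p \<Phi>(a)\<close> on \<open>{F > a}\<close> that
  the weak type inequality at height \<open>a\<close> produces for the part of the sequence above \<open>a\<close>.\<close>

definition upper_piece :: "(real \<Rightarrow> real) \<Rightarrow> real \<Rightarrow> real \<Rightarrow> ennreal \<Rightarrow> ennreal" where
  "upper_piece \<Phi> p a u =
     ennreal (a powr - p) * (rpow (if ennreal a < u then u else 0) p * ennreal (\<Phi> a))"

definition lower_piece :: "(real \<Rightarrow> real) \<Rightarrow> real \<Rightarrow> real \<Rightarrow> ennreal \<Rightarrow> ennreal" where
  "lower_piece \<Phi> p a u =
     ennreal (a powr - p) * (rpow (if u \<le> ennreal a then u else 0) p * ennreal (\<Phi> a))"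

lemma orlicz_function_nonneg:
  assumes "orlicz_function \<Phi>" "0 \<le> t"
  shows "0 \<le> \<Phi> t"
  using assms by (cases "t = 0") (auto simp: orlicz_function_def less_imp_le)

lemma orlicz_function_mono:
  assumes "orlicz_function \<Phi>" "0 \<le> s" "s \<le> t"
  shows "\<Phi> s \<le> \<Phi> t"
  using assms by (auto simp: orlicz_function_def mono_on_def)

text \<open>For \<open>a < t\<close>, the lower type with scaling factor \<open>a / t\<close> bounds \<open>(t / a)\<^sup>p \<Phi>(a)\<close> by
  \<open>C (a / t)\<^bsup>q - p\<^esup> \<Phi>(t)\<close>, and the exponent is positive, so the sum over \<open>a = 2\<^sup>k < t\<close> is
  geometric.\<close>

lemma sum_upper_piece_le:
  assumes \<Phi>: "orlicz_function \<Phi>" and C: "0 < C" and p: "p < q"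
    and lower: "\<And>s t. 0 \<le> t \<Longrightarrow> 0 \<le> s \<Longrightarrow> s \<le> 1 \<Longrightarrow> \<Phi> (s * t) \<le> C * s powr q * \<Phi> t"
  shows "(\<integral>\<^sup>+k. upper_piece \<Phi> p (2 powr real_of_int k) u \<partial>count_space UNIV)
    \<le> ennreal (C / (1 - 2 powr - (q - p))) * orlicz_ext \<Phi> u"
proof -
  have const: "0 < C / (1 - 2 powr - (q - p))"
    using C p powr_less_mono[of "- (q - p)" 0 "2::real"] by simp
  consider "u = \<infinity>" | "u = 0" | t where "0 < t" "u = ennreal t"
    by (cases u) (auto simp: ennreal_eq_0_iff less_le)
  then show ?thesis
  proof cases
    case 1
    with const show ?thesis
      by (auto simp: orlicz_ext_def ennreal_mult_top)
  next
    case 2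
    then show ?thesis
      by (simp add: upper_piece_def)
  next
    case (3 t)
    have "upper_piece \<Phi> p (2 powr real_of_int k) u \<le> ennreal (C * \<Phi> t) *
        (if 2 powr real_of_int k < t then ennreal ((2 powr k / t) powr (q - p)) else 0)" for k
    proof (cases "2 powr real_of_int k < t")
      case True
      define a where "a = 2 powr real_of_int k"
      have a: "0 < a" "a < t"
        using True by (auto simp: a_def)
      have "\<Phi> a \<le> C * (a / t) powr q * \<Phi> t"
        using lower[of t "a / t"] a by simp
      then have "(a powr - p * t powr p) * \<Phi> a \<le> (a powr - p * t powr p) * (C * (a / t) powr q * \<Phi> t)"
        by (intro mult_left_mono) auto
      also have "\<dots> = C * \<Phi> t * (a / t) powr (q - p)"
        using a by (simp add: powr_divide powr_diff powr_minus field_simps)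
      finally show ?thesis
        using True 3 a orlicz_function_nonneg[OF \<Phi>] C
        unfolding upper_piece_def a_def[symmetric]
        by (simp add: rpow_def mult.assoc ennreal_leI flip: ennreal_mult)
    qed (use 3 in \<open>simp add: upper_piece_def ennreal_less_iff\<close>)
    then have "(\<integral>\<^sup>+k. upper_piece \<Phi> p (2 powr real_of_int k) u \<partial>count_space UNIV)
        \<le> (\<integral>\<^sup>+k. ennreal (C * \<Phi> t) *
            (if 2 powr real_of_int k < t then ennreal ((2 powr k / t) powr (q - p)) else 0) \<partial>count_space UNIV)"
      by (intro nn_integral_mono)
    also have "\<dots> \<le> ennreal (C * \<Phi> t) * ennreal (1 / (1 - 2 powr - (q - p)))"
      using 3 p sum_dyadic_below[of t "q - p"]
      by (subst nn_integral_cmult) (auto intro: mult_left_mono)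
    also have "\<dots> = ennreal (C / (1 - 2 powr - (q - p))) * orlicz_ext \<Phi> u"
      using 3 C const orlicz_function_nonneg[OF \<Phi>]
      by (simp add: orlicz_ext_def zero_less_divide_iff mult.commute flip: ennreal_mult)
    finally show ?thesis .
  qed
qed

text \<open>For \<open>a \<ge> t\<close>, the upper type with scaling factor \<open>a / t\<close> bounds \<open>(t / a)\<^sup>p \<Phi>(a)\<close> by
  \<open>C (t / a)\<^bsup>p - q\<^esup> \<Phi>(t)\<close>, and now \<open>p\<close> has to exceed \<open>q\<close>.\<close>

lemma sum_lower_piece_le:
  assumes \<Phi>: "orlicz_function \<Phi>" and C: "0 < C" and p: "q < p"
    and upper: "\<And>s t. 0 \<le> t \<Longrightarrow> 1 \<le> s \<Longrightarrow> \<Phi> (s * t) \<le> C * s powr q * \<Phi> t"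
  shows "(\<integral>\<^sup>+k. lower_piece \<Phi> p (2 powr real_of_int k) u \<partial>count_space UNIV)
    \<le> ennreal (C / (1 - 2 powr - (p - q))) * orlicz_ext \<Phi> u"
proof -
  have const: "0 < C / (1 - 2 powr - (p - q))"
    using C p powr_less_mono[of "- (p - q)" 0 "2::real"] by simp
  consider "u = \<infinity>" | "u = 0" | t where "0 < t" "u = ennreal t"
    by (cases u) (auto simp: ennreal_eq_0_iff less_le)
  then show ?thesis
  proof cases
    case 1
    with const show ?thesis
      by (auto simp: orlicz_ext_def ennreal_mult_top)
  next
    case 2
    then show ?thesis
      by (simp add: lower_piece_def)
  next
    case (3 t)
    have "lower_piece \<Phi> p (2 powr real_of_int k) u \<le> ennreal (C * \<Phi> t) *
        (if t \<le> 2 powr real_of_int k then ennreal ((t / 2 powr k) powr (p - q)) else 0)" for k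
    proof (cases "t \<le> 2 powr real_of_int k")
      case True
      define a where "a = 2 powr real_of_int k"
      have a: "0 < a" "t \<le> a"
        using True by (auto simp: a_def)
      have "\<Phi> a \<le> C * (a / t) powr q * \<Phi> t"
        using upper[of t "a / t"] a 3 by simp
      then have "(a powr - p * t powr p) * \<Phi> a \<le> (a powr - p * t powr p) * (C * (a / t) powr q * \<Phi> t)"
        by (intro mult_left_mono) auto
      also have "\<dots> = C * \<Phi> t * (t / a) powr (p - q)"
        using a 3 by (simp add: powr_divide powr_diff powr_minus field_simps)
      finally show ?thesis
        using True 3 a orlicz_function_nonneg[OF \<Phi>] C
        unfolding lower_piece_def a_def[symmetric]
        by (simp add: rpow_def mult.assoc ennreal_leI flip: ennreal_mult)
    qed (use 3 in \<open>simp add: lower_piece_def\<close>)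
    then have "(\<integral>\<^sup>+k. lower_piece \<Phi> p (2 powr real_of_int k) u \<partial>count_space UNIV)
        \<le> (\<integral>\<^sup>+k. ennreal (C * \<Phi> t) *
            (if t \<le> 2 powr real_of_int k then ennreal ((t / 2 powr k) powr (p - q)) else 0) \<partial>count_space UNIV)"
      by (intro nn_integral_mono)
    also have "\<dots> \<le> ennreal (C * \<Phi> t) * ennreal (1 / (1 - 2 powr - (p - q)))"
      using 3 p sum_dyadic_above[of t "p - q"]
      by (subst nn_integral_cmult) (auto intro: mult_left_mono)
    also have "\<dots> = ennreal (C / (1 - 2 powr - (p - q))) * orlicz_ext \<Phi> u"
      using 3 C const orlicz_function_nonneg[OF \<Phi>]
      by (simp add: orlicz_ext_def zero_less_divide_iff mult.commute flip: ennreal_mult)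
    finally show ?thesis .
  qed
qed

text \<open>A single term of the sum is enough when \<open>u\<close> is finite and positive: the one for the
  largest \<open>2\<^sup>k\<close> below \<open>u\<close>, since \<open>\<Phi>(u) \<le> \<Phi>(2 \<cdot> 2\<^sup>k)\<close>. For \<open>u = \<infinity>\<close> the sum is infinite,
  because infinitely many of its terms are at least \<open>\<Phi>(1)\<close>.\<close>

lemma orlicz_ext_le_dyadic_sum:
  assumes \<Phi>: "orlicz_function \<Phi>" and C: "0 < C"
    and upper: "\<And>s t. 0 \<le> t \<Longrightarrow> 1 \<le> s \<Longrightarrow> \<Phi> (s * t) \<le> C * s powr q * \<Phi> t"
  shows "orlicz_ext \<Phi> u \<le> ennreal (C * 2 powr q) *
    (\<integral>\<^sup>+k. ennreal (\<Phi> (2 powr real_of_int k)) * indicator {ennreal (2 powr k)<..} u \<partial>count_space UNIV)"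
    (is "_ \<le> _ * ?sum")
proof -
  consider "u = \<infinity>" | "u = 0" | t where "0 < t" "u = ennreal t"
    by (cases u) (auto simp: ennreal_eq_0_iff less_le)
  then show ?thesis
  proof cases
    case 1
    have "0 < \<Phi> 1"
      using \<Phi> by (auto simp: orlicz_function_def)
    have "\<infinity> = (\<integral>\<^sup>+k. ennreal (\<Phi> 1) * indicator {0..} k \<partial>count_space (UNIV :: int set))"
      using \<open>0 < \<Phi> 1\<close>
      by (subst nn_integral_cmult_indicator) (auto simp: ennreal_mult_top infinite_Ici)
    also have "\<dots> \<le> ?sum"
      using 1 by (intro nn_integral_mono)
        (auto simp: indicator_def intro!: ennreal_leI orlicz_function_mono[OF \<Phi>] ge_one_powr_ge_zero)
    finally show ?thesis
      using C by (auto simp: top_unique ennreal_mult_top)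
  next
    case 2
    then show ?thesis
      using \<Phi> by (simp add: orlicz_ext_def orlicz_function_def)
  next
    case (3 t)
    obtain m :: int where m: "2 powr m < t" "t \<le> 2 powr (m + 1)"
      using ex_dyadic_interval[OF \<open>0 < t\<close>] .
    have "\<Phi> t \<le> \<Phi> (2 * 2 powr m)"
      using m 3 by (intro orlicz_function_mono[OF \<Phi>]) (auto simp: powr_add mult.commute)
    also have "\<dots> \<le> C * 2 powr q * \<Phi> (2 powr m)"
      by (rule upper) auto
    finally have "orlicz_ext \<Phi> u \<le> ennreal (C * 2 powr q) *
        (ennreal (\<Phi> (2 powr real_of_int m)) * indicator {ennreal (2 powr m)<..} u)"
      using 3 m C orlicz_function_nonneg[OF \<Phi>]
      by (simp add: orlicz_ext_def ennreal_leI ennreal_less_iff flip: ennreal_mult)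
    also have "\<dots> \<le> ennreal (C * 2 powr q) * ?sum"
      by (intro mult_left_mono nn_integral_ge_point) auto
    finally show ?thesis .
  qed
qed

section \<open>Integrated dyadic estimates\<close>

lemma sum_power_modular_upper_le:
  assumes \<phi>: "musielak_orlicz \<phi>" and C: "0 < C" and p: "p < q"
    and lower: "\<And>x s t. 0 \<le> t \<Longrightarrow> 0 \<le> s \<Longrightarrow> s \<le> 1 \<Longrightarrow> \<phi> x (s * t) \<le> C * s powr q * \<phi> x t"
    and [measurable]: "F \<in> borel_measurable lebesgue"
  shows "(\<integral>\<^sup>+k. ennreal ((2 powr real_of_int k) powr - p) *
      power_modular \<phi> (2 powr k) p (\<lambda>x. if ennreal (2 powr k) < F x then F x else 0) \<partial>count_space UNIV)
    \<le> ennreal (C / (1 - 2 powr - (q - p))) * mo_modular \<phi> F"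
proof -
  have orl: "orlicz_function (\<phi> x)" and [measurable]: "0 \<le> t \<Longrightarrow> (\<lambda>x. \<phi> x t) \<in> borel_measurable lebesgue" for x t
    using \<phi> by (auto simp: musielak_orlicz_def)
  have [measurable]: "(\<lambda>x. \<phi> x (2 powr real_of_int k)) \<in> borel_measurable lebesgue" for k
    by simp
  have const: "0 < C / (1 - 2 powr - (q - p))"
    using C p powr_less_mono[of "- (q - p)" 0 "2::real"] by simp
  have "(\<integral>\<^sup>+k. ennreal ((2 powr real_of_int k) powr - p) *
      power_modular \<phi> (2 powr k) p (\<lambda>x. if ennreal (2 powr k) < F x then F x else 0) \<partial>count_space UNIV)
    = (\<integral>\<^sup>+k. \<integral>\<^sup>+x. upper_piece (\<phi> x) p (2 powr real_of_int k) (F x) \<partial>lebesgue \<partial>count_space UNIV)"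
    unfolding power_modular_def upper_piece_def by (simp add: nn_integral_cmult)
  also have "\<dots> = (\<integral>\<^sup>+x. \<integral>\<^sup>+k. upper_piece (\<phi> x) p (2 powr real_of_int k) (F x) \<partial>count_space UNIV \<partial>lebesgue)"
    unfolding upper_piece_def by (rule nn_integral_count_space_nn_integral[symmetric]) auto
  also have "\<dots> \<le> (\<integral>\<^sup>+x. ennreal (C / (1 - 2 powr - (q - p))) * orlicz_ext (\<phi> x) (F x) \<partial>lebesgue)"
    using lower by (intro nn_integral_mono sum_upper_piece_le orl C p) auto
  also have "\<dots> \<le> ennreal (C / (1 - 2 powr - (q - p))) * mo_modular \<phi> F"
    unfolding mo_modular_def by (rule nn_integral_cmult_le[OF const])
  finally show ?thesis .
qed

lemma sum_power_modular_lower_le: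
  assumes \<phi>: "musielak_orlicz \<phi>" and C: "0 < C" and p: "q < p"
    and upper: "\<And>x s t. 0 \<le> t \<Longrightarrow> 1 \<le> s \<Longrightarrow> \<phi> x (s * t) \<le> C * s powr q * \<phi> x t"
    and [measurable]: "F \<in> borel_measurable lebesgue"
  shows "(\<integral>\<^sup>+k. ennreal ((2 powr real_of_int k) powr - p) *
      power_modular \<phi> (2 powr k) p (\<lambda>x. if F x \<le> ennreal (2 powr k) then F x else 0) \<partial>count_space UNIV)
    \<le> ennreal (C / (1 - 2 powr - (p - q))) * mo_modular \<phi> F"
proof -
  have orl: "orlicz_function (\<phi> x)" and [measurable]: "0 \<le> t \<Longrightarrow> (\<lambda>x. \<phi> x t) \<in> borel_measurable lebesgue" for x t
    using \<phi> by (auto simp: musielak_orlicz_def)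
  have [measurable]: "(\<lambda>x. \<phi> x (2 powr real_of_int k)) \<in> borel_measurable lebesgue" for k
    by simp
  have const: "0 < C / (1 - 2 powr - (p - q))"
    using C p powr_less_mono[of "- (p - q)" 0 "2::real"] by simp
  have "(\<integral>\<^sup>+k. ennreal ((2 powr real_of_int k) powr - p) *
      power_modular \<phi> (2 powr k) p (\<lambda>x. if F x \<le> ennreal (2 powr k) then F x else 0) \<partial>count_space UNIV)
    = (\<integral>\<^sup>+k. \<integral>\<^sup>+x. lower_piece (\<phi> x) p (2 powr real_of_int k) (F x) \<partial>lebesgue \<partial>count_space UNIV)"
    unfolding power_modular_def lower_piece_def by (simp add: nn_integral_cmult)
  also have "\<dots> = (\<integral>\<^sup>+x. \<integral>\<^sup>+k. lower_piece (\<phi> x) p (2 powr real_of_int k) (F x) \<partial>count_space UNIV \<partial>lebesgue)"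
    unfolding lower_piece_def by (rule nn_integral_count_space_nn_integral[symmetric]) auto
  also have "\<dots> \<le> (\<integral>\<^sup>+x. ennreal (C / (1 - 2 powr - (p - q))) * orlicz_ext (\<phi> x) (F x) \<partial>lebesgue)"
    using upper by (intro nn_integral_mono sum_lower_piece_le orl C p) auto
  also have "\<dots> \<le> ennreal (C / (1 - 2 powr - (p - q))) * mo_modular \<phi> F"
    unfolding mo_modular_def by (rule nn_integral_cmult_le[OF const])
  finally show ?thesis .
qed

text \<open>The integrated form of \<open>orlicz_ext_le_dyadic_sum\<close>. The right-hand side involves
  \<open>\<phi>(\<cdot>, t)\<close> only for countably many fixed \<open>t\<close>, whence its measurability.\<close>

lemma mo_modular_le_dyadic_sum:
  assumes \<phi>: "musielak_orlicz \<phi>" and C: "0 < C"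
    and upper: "\<And>x s t. 0 \<le> t \<Longrightarrow> 1 \<le> s \<Longrightarrow> \<phi> x (s * t) \<le> C * s powr q * \<phi> x t"
    and [measurable]: "G \<in> borel_measurable lebesgue"
  shows "mo_modular \<phi> G \<le> ennreal (C * 2 powr q) *
    (\<integral>\<^sup>+k. mo_measure \<phi> {x. ennreal (2 powr real_of_int k) < G x} (2 powr k) \<partial>count_space UNIV)"
proof -
  have orl: "orlicz_function (\<phi> x)" and [measurable]: "(\<lambda>x. \<phi> x (2 powr real_of_int k)) \<in> borel_measurable lebesgue" for x k
    using \<phi> by (auto simp: musielak_orlicz_def)
  have const: "0 < C * 2 powr q" using C by simp
  have "mo_modular \<phi> G \<le> (\<integral>\<^sup>+x. ennreal (C * 2 powr q) *
      (\<integral>\<^sup>+k. ennreal (\<phi> x (2 powr real_of_int k)) * indicator {ennreal (2 powr k)<..} (G x) \<partial>count_space UNIV) \<partial>lebesgue)"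
    unfolding mo_modular_def
    using upper by (intro nn_integral_mono orlicz_ext_le_dyadic_sum orl C) auto
  also have "\<dots> \<le> ennreal (C * 2 powr q) * (\<integral>\<^sup>+x. \<integral>\<^sup>+k. ennreal (\<phi> x (2 powr real_of_int k))
      * indicator {ennreal (2 powr k)<..} (G x) \<partial>count_space UNIV \<partial>lebesgue)"
    by (rule nn_integral_cmult_le[OF const])
  also have "(\<integral>\<^sup>+x. \<integral>\<^sup>+k. ennreal (\<phi> x (2 powr real_of_int k))
      * indicator {ennreal (2 powr k)<..} (G x) \<partial>count_space UNIV \<partial>lebesgue)
    = (\<integral>\<^sup>+k. \<integral>\<^sup>+x. ennreal (\<phi> x (2 powr real_of_int k))
      * indicator {ennreal (2 powr k)<..} (G x) \<partial>lebesgue \<partial>count_space UNIV)"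
    by (rule nn_integral_count_space_nn_integral) auto
  also have "\<dots> = (\<integral>\<^sup>+k. mo_measure \<phi> {x. ennreal (2 powr real_of_int k) < G x} (2 powr k) \<partial>count_space UNIV)"
    unfolding mo_measure_def by (intro nn_integral_cong) (simp add: indicator_def)
  finally show ?thesis .
qed

section \<open>Cutting the sequence and the level sets\<close>

text \<open>Membership in the weighted classes is measured at \<open>t = 1\<close>, whereas the dyadic estimates
  control the modulars at \<open>t = 2\<^sup>k\<close>. Monotonicity (for \<open>t \<ge> 1\<close>) or the upper type (for
  \<open>t < 1\<close>) bounds \<open>\<phi>(x, 1)\<close> by a multiple of \<open>\<phi>(x, t)\<close> uniformly in \<open>x\<close>.\<close>

lemma power_modular_1_le:
  assumes \<phi>: "musielak_orlicz \<phi>" and "uniformly_upper_type \<phi> q" and t: "0 < t"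
  obtains K where "0 < K" "\<And>p g. power_modular \<phi> 1 p g \<le> ennreal K * power_modular \<phi> t p g"
proof -
  obtain C where C: "0 < C" "\<And>x t s. 0 \<le> t \<Longrightarrow> 1 \<le> s \<Longrightarrow> \<phi> x (s * t) \<le> C * s powr q * \<phi> x t"
    using assms(2) unfolding uniformly_upper_type_def by blast
  have orl: "orlicz_function (\<phi> x)" for x
    using \<phi> by (simp add: musielak_orlicz_def)
  define K where "K = max 1 (C * (1 / t) powr q)"
  have K: "0 < K" by (simp add: K_def)
  have "\<phi> x 1 \<le> K * \<phi> x t" for x
  proof (cases "1 \<le> t")
    case True
    then have "\<phi> x 1 \<le> 1 * \<phi> x t"
      using orlicz_function_mono[OF orl, of 1 t x] by simp
    also have "\<dots> \<le> K * \<phi> x t"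
      using t orlicz_function_nonneg[OF orl] by (intro mult_right_mono) (auto simp: K_def)
    finally show ?thesis .
  next
    case False
    then have "\<phi> x 1 \<le> C * (1 / t) powr q * \<phi> x t"
      using C(2)[of t "1 / t" x] t by simp
    also have "\<dots> \<le> K * \<phi> x t"
      using t orlicz_function_nonneg[OF orl] by (intro mult_right_mono) (auto simp: K_def)
    finally show ?thesis .
  qed
  then have *: "ennreal (\<phi> x 1) \<le> ennreal K * ennreal (\<phi> x t)" for x
    using K t orlicz_function_nonneg[OF orl] by (simp add: ennreal_leI flip: ennreal_mult)
  have "power_modular \<phi> 1 p g \<le> ennreal K * power_modular \<phi> t p g" for p g
  proof -
    have "power_modular \<phi> 1 p g \<le> (\<integral>\<^sup>+x. ennreal K * (rpow (g x) p * ennreal (\<phi> x t)) \<partial>lebesgue)"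
      unfolding power_modular_def
      using mult_left_mono[OF *, of "rpow (g _) p"] by (intro nn_integral_mono) (simp add: mult.left_commute)
    also have "\<dots> \<le> ennreal K * power_modular \<phi> t p g"
      unfolding power_modular_def by (rule nn_integral_cmult_le[OF K])
    finally show ?thesis .
  qed
  with K that show ?thesis by blast
qed

lemma Lp_weighted_seq_if:
  assumes \<phi>: "musielak_orlicz \<phi>" "uniformly_upper_type \<phi> q" and t: "0 < t" and [measurable]: "\<And>j. f j \<in> borel_measurable lebesgue"
    and [measurable]: "Measurable.pred lebesgue P"
    and fin: "power_modular \<phi> t p (\<lambda>x. if P x then lr_norm r (\<lambda>j. f j x) else 0) < \<infinity>"
  shows "(\<lambda>j x. if P x then f j x else 0) \<in> Lp_weighted_seq \<phi> p r"
proof -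
  obtain K where K: "0 < K" "\<And>p g. power_modular \<phi> 1 p g \<le> ennreal K * power_modular \<phi> t p g"
    using power_modular_1_le[OF \<phi> t] by blast
  have "power_modular \<phi> 1 p (\<lambda>x. if P x then lr_norm r (\<lambda>j. f j x) else 0) < \<infinity>"
    using K(2)[of p "\<lambda>x. if P x then lr_norm r (\<lambda>j. f j x) else 0"] fin
    by (auto simp: ennreal_mult_less_top intro: le_less_trans)
  moreover have "(\<lambda>x. if P x then f j x else 0) \<in> borel_measurable lebesgue" for j
    by measurable
  ultimately show ?thesis
    by (simp add: Lp_weighted_seq_def lr_norm_if)
qed

text \<open>\<open>T\<close> acts on single functions, so the members of a sequence in the vector-valued class have
  to lie in the scalar class, where the properties of \<open>T\<close> are available.\<close>

lemma Lp_weighted_seq_imp_Lp_weighted: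
  assumes r: "1 \<le> r" and p: "0 < p" and f: "f \<in> Lp_weighted_seq \<phi> p r"
  shows "f j \<in> Lp_weighted \<phi> p"
proof -
  have "power_modular \<phi> 1 p (\<lambda>x. ennreal (norm (f j x))) \<le> power_modular \<phi> 1 p (\<lambda>x. lr_norm r (\<lambda>j. f j x))"
    unfolding power_modular_def
    using p by (intro nn_integral_mono mult_right_mono rpow_mono norm_le_lr_norm[OF r]) auto
  with f show ?thesis
    by (auto simp: Lp_weighted_def Lp_weighted_seq_def)
qed

lemma zero_in_Lp_weighted: "(\<lambda>x. 0) \<in> Lp_weighted \<phi> p"
  by (simp add: Lp_weighted_def power_modular_def)

text \<open>The exceptional null sets of sublinearity depend on \<open>j\<close>; there are countably many of them, so
  \<open>|T f\<^sub>j| \<le> |T g\<^sub>j| + |T h\<^sub>j|\<close> holds for all \<open>j\<close> at almost every point. At such a point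
  the quasi-triangle inequality makes one of the two norms exceed \<open>\<alpha> / 4\<close> whenever the norm of
  \<open>{T f\<^sub>j}\<close> exceeds \<open>\<alpha>\<close>.\<close>

lemma level_set_estimate:
  fixes \<phi> :: "real ^ 'n \<Rightarrow> real \<Rightarrow> real"
    and T :: "(real ^ 'n \<Rightarrow> 'a::{real_normed_field, euclidean_space}) \<Rightarrow> real ^ 'n \<Rightarrow> 'a"
  assumes r: "1 \<le> r" and \<phi>: "musielak_orlicz \<phi>" and p: "0 < p1" "0 < p2" and t: "0 < t" and \<alpha>: "0 < \<alpha>"
    and T: "sublinear_operator_on (fun_set_sum (Lp_weighted \<phi> p1) (Lp_weighted \<phi> p2)) T"
    and weak1: "\<And>f \<alpha> t. f \<in> Lp_weighted_seq \<phi> p1 r \<Longrightarrow> 0 < \<alpha> \<Longrightarrow> 0 < t \<Longrightarrow>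
        mo_measure \<phi> {x. lr_norm r (\<lambda>j. T (f j) x) > ennreal \<alpha>} t
          \<le> ennreal (C1 * \<alpha> powr (-p1)) * power_modular \<phi> t p1 (\<lambda>x. lr_norm r (\<lambda>j. f j x))"
    and weak2: "\<And>f \<alpha> t. f \<in> Lp_weighted_seq \<phi> p2 r \<Longrightarrow> 0 < \<alpha> \<Longrightarrow> 0 < t \<Longrightarrow>
        mo_measure \<phi> {x. lr_norm r (\<lambda>j. T (f j) x) > ennreal \<alpha>} t
          \<le> ennreal (C2 * \<alpha> powr (-p2)) * power_modular \<phi> t p2 (\<lambda>x. lr_norm r (\<lambda>j. f j x))"
    and g: "g \<in> Lp_weighted_seq \<phi> p1 r" and h: "h \<in> Lp_weighted_seq \<phi> p2 r"
    and f: "\<And>j x. f j x = g j x + h j x"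
  shows "mo_measure \<phi> {x. lr_norm r (\<lambda>j. T (f j) x) > ennreal \<alpha>} t
    \<le> ennreal (C1 * (\<alpha> / 4) powr (-p1)) * power_modular \<phi> t p1 (\<lambda>x. lr_norm r (\<lambda>j. g j x))
     + ennreal (C2 * (\<alpha> / 4) powr (-p2)) * power_modular \<phi> t p2 (\<lambda>x. lr_norm r (\<lambda>j. h j x))"
    and "(\<lambda>x. lr_norm r (\<lambda>j. T (f j) x)) \<in> borel_measurable lebesgue"
proof -
  let ?D = "fun_set_sum (Lp_weighted \<phi> p1) (Lp_weighted \<phi> p2)"
  have g': "g j \<in> Lp_weighted \<phi> p1" and h': "h j \<in> Lp_weighted \<phi> p2" for j
    using Lp_weighted_seq_imp_Lp_weighted[OF r] p g h by auto
  have gD: "g j \<in> ?D" for j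
    unfolding fun_set_sum_def using g'[of j] zero_in_Lp_weighted[of \<phi> p2]
    by (intro CollectI exI[of _ "g j"] exI[of _ "\<lambda>x. 0"]) auto
  have hD: "h j \<in> ?D" for j
    unfolding fun_set_sum_def using h'[of j] zero_in_Lp_weighted[of \<phi> p1]
    by (intro CollectI exI[of _ "h j"] exI[of _ "\<lambda>x. 0"]) auto
  have fgh: "f j = (\<lambda>x. g j x + h j x)" for j
    using f by auto
  have fD: "f j \<in> ?D" for j
    unfolding fun_set_sum_def fgh using g' h' by blast
  have [measurable]: "T (f j) \<in> borel_measurable lebesgue" "T (g j) \<in> borel_measurable lebesgue"
      "T (h j) \<in> borel_measurable lebesgue" "(\<lambda>x. \<phi> x t) \<in> borel_measurable lebesgue" for j
    using T fD gD hD \<phi> t by (auto simp: sublinear_operator_on_def musielak_orlicz_def)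
  show "(\<lambda>x. lr_norm r (\<lambda>j. T (f j) x)) \<in> borel_measurable lebesgue"
    by measurable
  let ?G = "\<lambda>x. lr_norm r (\<lambda>j. T (g j) x)" and ?H = "\<lambda>x. lr_norm r (\<lambda>j. T (h j) x)"
  have "AE x in lebesgue. \<forall>j. norm (T (f j) x) \<le> norm (T (g j) x) + norm (T (h j) x)"
    unfolding AE_all_countable fgh using T gD hD by (auto simp: sublinear_operator_on_def)
  then have *: "AE x in lebesgue. ennreal \<alpha> < lr_norm r (\<lambda>j. T (f j) x) \<longrightarrow>
      ennreal (\<alpha> / 4) < ?G x \<or> ennreal (\<alpha> / 4) < ?H x"
  proof eventually_elim
    case (elim x)
    then have le: "lr_norm r (\<lambda>j. T (f j) x) \<le> 4 * max (?G x) (?H x)"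
      by (intro lr_norm_quasi_triangle[OF r]) auto
    have "lr_norm r (\<lambda>j. T (f j) x) \<le> ennreal \<alpha>" if "max (?G x) (?H x) \<le> ennreal (\<alpha> / 4)"
    proof -
      have "4 * max (?G x) (?H x) \<le> ennreal 4 * ennreal (\<alpha> / 4)"
        using that by (intro mult_mono) auto
      also have "\<dots> = ennreal (4 * (\<alpha> / 4))"
        using \<alpha> by (intro ennreal_mult[symmetric]) auto
      finally show ?thesis using le by simp
    qed
    then show ?case by (meson max.boundedI not_less)
  qed
  have "mo_measure \<phi> {x. lr_norm r (\<lambda>j. T (f j) x) > ennreal \<alpha>} t
      \<le> (\<integral>\<^sup>+x. ennreal (\<phi> x t) * indicator {x. ?G x > ennreal (\<alpha> / 4)} x
            + ennreal (\<phi> x t) * indicator {x. ?H x > ennreal (\<alpha> / 4)} x \<partial>lebesgue)"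
    unfolding mo_measure_def
    by (intro nn_integral_mono_AE, use * in eventually_elim) (auto simp: indicator_def)
  also have "\<dots> = mo_measure \<phi> {x. ?G x > ennreal (\<alpha> / 4)} t + mo_measure \<phi> {x. ?H x > ennreal (\<alpha> / 4)} t"
    unfolding mo_measure_def by (rule nn_integral_add) measurable
  also have "\<dots> \<le> ennreal (C1 * (\<alpha> / 4) powr (-p1)) * power_modular \<phi> t p1 (\<lambda>x. lr_norm r (\<lambda>j. g j x))
     + ennreal (C2 * (\<alpha> / 4) powr (-p2)) * power_modular \<phi> t p2 (\<lambda>x. lr_norm r (\<lambda>j. h j x))"
    using \<alpha> t by (intro add_mono weak1 weak2 g h) auto
  finally show "mo_measure \<phi> {x. lr_norm r (\<lambda>j. T (f j) x) > ennreal \<alpha>} t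
    \<le> ennreal (C1 * (\<alpha> / 4) powr (-p1)) * power_modular \<phi> t p1 (\<lambda>x. lr_norm r (\<lambda>j. g j x))
     + ennreal (C2 * (\<alpha> / 4) powr (-p2)) * power_modular \<phi> t p2 (\<lambda>x. lr_norm r (\<lambda>j. h j x))" .
qed

section \<open>Interpolation\<close>

theorem theorem2p9:
  fixes \<phi> :: "real ^ 'n \<Rightarrow> real \<Rightarrow> real"
    and T :: "(real ^ 'n \<Rightarrow> 'a::{real_normed_field, euclidean_space}) \<Rightarrow> real ^ 'n \<Rightarrow> 'a"
    and p1 p2 p_lo p_up :: real
    and r :: ennreal
  assumes "1 \<le> r"
    and "musielak_orlicz \<phi>"
    and "uniformly_lower_type \<phi> p_lo"
    and "uniformly_upper_type \<phi> p_up"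
    and "p1 < p2" "0 < p1" "p1 < p_lo" "p_lo \<le> p_up" "p_up < p2"
    and "sublinear_operator_on (fun_set_sum (Lp_weighted \<phi> p1) (Lp_weighted \<phi> p2)) T"
    and "\<And>p. p \<in> {p1, p2} \<Longrightarrow>
      \<exists>C>0. \<forall>f \<in> Lp_weighted_seq \<phi> p r. \<forall>\<alpha>>0. \<forall>t>0.
        mo_measure \<phi> {x. lr_norm r (\<lambda>j. T (f j) x) > ennreal \<alpha>} t
          \<le> ennreal (C * \<alpha> powr (-p)) * power_modular \<phi> t p (\<lambda>x. lr_norm r (\<lambda>j. f j x))"
  shows "\<exists>C>0. \<forall>f \<in> L_mo_seq \<phi> r.
      mo_modular \<phi> (\<lambda>x. lr_norm r (\<lambda>j. T (f j) x))
        \<le> ennreal C * mo_modular \<phi> (\<lambda>x. lr_norm r (\<lambda>j. f j x))"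
proof -
  note r = assms(1) and \<phi> = assms(2) and T = assms(10)
  obtain A where A: "0 < A" "\<And>x s t. 0 \<le> t \<Longrightarrow> 0 \<le> s \<Longrightarrow> s \<le> 1 \<Longrightarrow> \<phi> x (s * t) \<le> A * s powr p_lo * \<phi> x t"
    using assms(3) unfolding uniformly_lower_type_def by (meson atLeastAtMost_iff)
  obtain B where B: "0 < B" "\<And>x s t. 0 \<le> t \<Longrightarrow> 1 \<le> s \<Longrightarrow> \<phi> x (s * t) \<le> B * s powr p_up * \<phi> x t"
    using assms(4) unfolding uniformly_upper_type_def by blast
  obtain C1 where C1: "0 < C1" and weak1: "\<And>f \<alpha> t. f \<in> Lp_weighted_seq \<phi> p1 r \<Longrightarrow> 0 < \<alpha> \<Longrightarrow> 0 < t \<Longrightarrow>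
        mo_measure \<phi> {x. lr_norm r (\<lambda>j. T (f j) x) > ennreal \<alpha>} t
          \<le> ennreal (C1 * \<alpha> powr (-p1)) * power_modular \<phi> t p1 (\<lambda>x. lr_norm r (\<lambda>j. f j x))"
    using assms(11)[of p1] by blast
  obtain C2 where C2: "0 < C2" and weak2: "\<And>f \<alpha> t. f \<in> Lp_weighted_seq \<phi> p2 r \<Longrightarrow> 0 < \<alpha> \<Longrightarrow> 0 < t \<Longrightarrow>
        mo_measure \<phi> {x. lr_norm r (\<lambda>j. T (f j) x) > ennreal \<alpha>} t
          \<le> ennreal (C2 * \<alpha> powr (-p2)) * power_modular \<phi> t p2 (\<lambda>x. lr_norm r (\<lambda>j. f j x))"
    using assms(11)[of p2] by blast
  define K1 where "K1 = A / (1 - 2 powr - (p_lo - p1))"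
  define K2 where "K2 = B / (1 - 2 powr - (p2 - p_up))"
  have K: "0 < K1" "0 < K2"
    using A B assms(7,9) powr_less_mono[of "- (p_lo - p1)" 0 "2::real"] powr_less_mono[of "- (p2 - p_up)" 0 "2::real"]
    by (simp_all add: K1_def K2_def)
  define c1 c2 where "c1 = C1 * 4 powr p1" and "c2 = C2 * 4 powr p2"
  have c: "0 < c1" "0 < c2"
    using C1 C2 by (simp_all add: c1_def c2_def)
  have "mo_modular \<phi> (\<lambda>x. lr_norm r (\<lambda>j. T (f j) x))
      \<le> ennreal (B * 2 powr p_up * (c1 * K1 + c2 * K2)) * mo_modular \<phi> (\<lambda>x. lr_norm r (\<lambda>j. f j x))"
    if f: "f \<in> L_mo_seq \<phi> r" for f
  proof -
    define F where "F x = lr_norm r (\<lambda>j. f j x)" for x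
    have [measurable]: "f j \<in> borel_measurable lebesgue" for j
      using f by (auto simp: L_mo_seq_def)
    have F [measurable]: "F \<in> borel_measurable lebesgue"
      unfolding F_def by measurable
    have fin: "mo_modular \<phi> F < \<infinity>"
      using f by (simp add: L_mo_seq_def F_def[abs_def])
    define U where "U k = power_modular \<phi> (2 powr real_of_int k) p1 (\<lambda>x. if ennreal (2 powr k) < F x then F x else 0)" for k
    define L where "L k = power_modular \<phi> (2 powr real_of_int k) p2 (\<lambda>x. if F x \<le> ennreal (2 powr k) then F x else 0)" for k
    have sumU: "(\<integral>\<^sup>+k. ennreal ((2 powr real_of_int k) powr - p1) * U k \<partial>count_space UNIV) \<le> ennreal K1 * mo_modular \<phi> F"
      unfolding U_def K1_def using A assms(7) by (intro sum_power_modular_upper_le \<phi> F) auto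
    have sumL: "(\<integral>\<^sup>+k. ennreal ((2 powr real_of_int k) powr - p2) * L k \<partial>count_space UNIV) \<le> ennreal K2 * mo_modular \<phi> F"
      unfolding L_def K2_def using B assms(9) by (intro sum_power_modular_lower_le \<phi> F) auto
    \<comment> \<open>Each term is bounded by its finite sum, so both parts at each height have finite modulars.\<close>
    have finU: "U k < \<infinity>" and finL: "L k < \<infinity>" for k
    proof -
      have "ennreal ((2 powr real_of_int k) powr - p1) * U k \<le> ennreal K1 * mo_modular \<phi> F"
        by (rule order_trans[OF nn_integral_ge_point sumU]) simp
      also have "\<dots> < \<infinity>" using fin by (simp add: ennreal_mult_less_top)
      finally show "U k < \<infinity>" by (auto simp: ennreal_mult_less_top)
      have "ennreal ((2 powr real_of_int k) powr - p2) * L k \<le> ennreal K2 * mo_modular \<phi> F"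
        by (rule order_trans[OF nn_integral_ge_point sumL]) simp
      also have "\<dots> < \<infinity>" using fin by (simp add: ennreal_mult_less_top)
      finally show "L k < \<infinity>" by (auto simp: ennreal_mult_less_top)
    qed
    define g where "g k j x = (if ennreal (2 powr real_of_int k) < F x then f j x else 0)" for k j x
    define h where "h k j x = (if F x \<le> ennreal (2 powr real_of_int k) then f j x else 0)" for k j x
    have g: "g k \<in> Lp_weighted_seq \<phi> p1 r" for k
      unfolding g_def
    proof (rule Lp_weighted_seq_if[OF \<phi> assms(4), of "2 powr k"])
      show "power_modular \<phi> (2 powr real_of_int k) p1 (\<lambda>x. if ennreal (2 powr real_of_int k) < F x then lr_norm r (\<lambda>j. f j x) else 0) < \<infinity>"
        using finU[of k] by (simp only: U_def F_def)
    qed (simp, measurable)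
    have h: "h k \<in> Lp_weighted_seq \<phi> p2 r" for k
      unfolding h_def
    proof (rule Lp_weighted_seq_if[OF \<phi> assms(4), of "2 powr k"])
      show "power_modular \<phi> (2 powr real_of_int k) p2 (\<lambda>x. if F x \<le> ennreal (2 powr real_of_int k) then lr_norm r (\<lambda>j. f j x) else 0) < \<infinity>"
        using finL[of k] by (simp only: L_def F_def)
    qed (simp, measurable)
    have gh: "f j x = g k j x + h k j x" for j x k
      by (auto simp: g_def h_def not_less)
    have p2: "0 < p2" using assms(5,6) by simp
    note est = level_set_estimate[OF r \<phi> assms(6) p2 _ _ T weak1 weak2 g h gh]
    have G: "(\<lambda>x. lr_norm r (\<lambda>j. T (f j) x)) \<in> borel_measurable lebesgue"
      by (rule est(2)[of 1 1]) auto
    have level: "mo_measure \<phi> {x. lr_norm r (\<lambda>j. T (f j) x) > ennreal (2 powr real_of_int k)} (2 powr k)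
        \<le> ennreal c1 * (ennreal ((2 powr real_of_int k) powr - p1) * U k)
         + ennreal c2 * (ennreal ((2 powr real_of_int k) powr - p2) * L k)" for k
    proof -
      have U: "U k = power_modular \<phi> (2 powr k) p1 (\<lambda>x. lr_norm r (\<lambda>j. g k j x))"
        and L: "L k = power_modular \<phi> (2 powr k) p2 (\<lambda>x. lr_norm r (\<lambda>j. h k j x))"
        unfolding U_def L_def g_def h_def F_def lr_norm_if by (rule refl)+
      \<comment> \<open>The passage from height \<open>2\<^sup>k\<close> to \<open>2\<^sup>k / 4\<close> costs the factor \<open>4\<^sup>p\<close> contained in \<open>c1\<close> and \<open>c2\<close>.\<close>
      have pow: "C * (2 powr real_of_int k / 4) powr - p = C * 4 powr p * (2 powr k) powr - p" for C p
        by (simp add: powr_divide powr_minus field_simps)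
      show ?thesis
        using est(1)[of "2 powr k" "2 powr k" k] c
        unfolding U[symmetric] L[symmetric] pow c1_def[symmetric] c2_def[symmetric]
        by (simp add: ennreal_mult mult.assoc)
    qed
    have "mo_modular \<phi> (\<lambda>x. lr_norm r (\<lambda>j. T (f j) x)) \<le> ennreal (B * 2 powr p_up) *
        (\<integral>\<^sup>+k. mo_measure \<phi> {x. ennreal (2 powr real_of_int k) < lr_norm r (\<lambda>j. T (f j) x)} (2 powr k) \<partial>count_space UNIV)"
      using B by (intro mo_modular_le_dyadic_sum \<phi> G) auto
    also have "\<dots> \<le> ennreal (B * 2 powr p_up) *
        (\<integral>\<^sup>+k. ennreal c1 * (ennreal ((2 powr real_of_int k) powr - p1) * U k)
         + ennreal c2 * (ennreal ((2 powr real_of_int k) powr - p2) * L k) \<partial>count_space UNIV)"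
      using level by (intro mult_left_mono nn_integral_mono) auto
    also have "\<dots> = ennreal (B * 2 powr p_up) *
        (ennreal c1 * (\<integral>\<^sup>+k. ennreal ((2 powr real_of_int k) powr - p1) * U k \<partial>count_space UNIV)
         + ennreal c2 * (\<integral>\<^sup>+k. ennreal ((2 powr real_of_int k) powr - p2) * L k \<partial>count_space UNIV))"
      by (simp add: nn_integral_add nn_integral_cmult)
    also have "\<dots> \<le> ennreal (B * 2 powr p_up) *
        (ennreal c1 * (ennreal K1 * mo_modular \<phi> F) + ennreal c2 * (ennreal K2 * mo_modular \<phi> F))"
      by (intro mult_left_mono add_mono sumU sumL) auto
    also have "\<dots> = ennreal (B * 2 powr p_up * (c1 * K1 + c2 * K2)) * mo_modular \<phi> F"
      using B(1) c K by (simp add: ennreal_mult ennreal_plus algebra_simps)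
    finally show ?thesis
      unfolding F_def .
  qed
  moreover have "0 < B * 2 powr p_up * (c1 * K1 + c2 * K2)"
    using B(1) c K by (simp add: add_pos_pos)
  ultimately show ?thesis
    by blast
qed

end
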